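(* Let $(P,\preceq)$ be a locally finite lattice and $f:P\to\mathbb{C}$. Let $X=\{x_1,\dots,x_n\}$ and $Y=\{y_1,\dots,y_n\}$ be subsets of $P$, indexed so that $x_i\preceq x_j\Rightarrow i\le j$ and $y_i\preceq y_j\Rightarrow i\le j$. Let $D=\{d_1,\dots,d_m\}$ be any finite subset of $P$ containing all elements $x_i\vee y_j$, indexed so that $d_i\preceq d_j\Rightarrow i\le j$. Then: (i) if $n>m$, then $\det[X,Y]_f=0$; (ii) if $n\le m$, then $$\det[X,Y]_f=\sum_{1\le k_1<k_2<\cdots<k_n\le m}\det E(X)_{(k_1,\dots,k_n)}\,\det E(Y)_{(k_1,\dots,k_n)}\,\Psi_{D,f}(d_{k_1})\Psi_{D,f}(d_{k_2})\cdots\Psi_{D,f}(d_{k_n}).$$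
   Context: $[X,Y]_f$ denotes the $n\times n$ matrix with $(i,j)$ entry $f(x_i\vee y_j)$. The function $\Psi_{D,f}$ on $D$ is defined recursively by $\Psi_{D,f}(d_k)=f(d_k)-\sum_{d_v\in D,\ d_k\prec d_v}\Psi_{D,f}(d_v)$, equivalently $f(d_k)=\sum_{d_v\in D,\ d_k\preceq d_v}\Psi_{D,f}(d_v)$. $E(X)$ is the $n\times m$ matrix with $(i,j)$ entry $1$ if $x_i\preceq d_j$ and $0$ otherwise; $E(Y)$ is defined likewise with $y_i$ in place of $x_i$. For an $n\times m$ matrix $A$ and $1\le k_1<\dots<k_n\le m$, $A_{(k_1,\dots,k_n)}$ is the $n\times n$ submatrix of $A$ consisting of columns $k_1,\dots,k_n$. *)

theory Defs
  imports "Jordan_Normal_Form.Determinant"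
begin

text \<open>Matrices are indexed from 0, so the informal indices \<open>1, \<dots>, n\<close> become \<open>0, \<dots>, n - 1\<close>.\<close>

definition join_matrix ::
  "nat \<Rightarrow> (nat \<Rightarrow> 'a::lattice) \<Rightarrow> (nat \<Rightarrow> 'a) \<Rightarrow> ('a \<Rightarrow> complex) \<Rightarrow> complex mat" where
  "join_matrix n x y f = mat n n (\<lambda>(i, j). f (sup (x i) (y j)))"

definition incidence_matrix ::
  "nat \<Rightarrow> nat \<Rightarrow> (nat \<Rightarrow> 'a::order) \<Rightarrow> (nat \<Rightarrow> 'a) \<Rightarrow> complex mat" where
  "incidence_matrix n m x d = mat n m (\<lambda>(i, j). if x i \<le> d j then 1 else 0)"

definition column_submatrix :: "'a mat \<Rightarrow> nat list \<Rightarrow> 'a mat" where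
  "column_submatrix A ks = mat_of_cols (dim_row A) (map (col A) ks)"

definition increasing_tuples :: "nat \<Rightarrow> nat \<Rightarrow> nat list set" where
  "increasing_tuples n m = {ks. length ks = n \<and> sorted_wrt (<) ks \<and> set ks \<subseteq> {..<m}}"

text \<open>Only finite \<open>D\<close> and arguments in \<open>D\<close> are meaningful; the finiteness test serves termination.\<close>

function Psi :: "'a::order set \<Rightarrow> ('a \<Rightarrow> complex) \<Rightarrow> 'a \<Rightarrow> complex" where
  "Psi D f d = (if finite D then f d - (\<Sum>v\<in>{v \<in> D. d < v}. Psi D f v) else 0)"
  by pat_completeness auto
termination
proof (relation "measure (\<lambda>(D, f, d). card {v \<in> D. d < v})")
  fix D :: "'a set" and f :: "'a \<Rightarrow> complex" and d v :: 'a
  assume "finite D" and v: "v \<in> {v \<in> D. d < v}"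
  then have "{w \<in> D. v < w} \<subset> {w \<in> D. d < w}"
    by (auto intro: less_trans)
  then show "((D, f, v), (D, f, d)) \<in> measure (\<lambda>(D, f, d). card {v \<in> D. d < v})"
    using \<open>finite D\<close> by (simp add: psubset_card_mono)
qed simp

declare Psi.simps [simp del]

lemma sum_Psi_above:
  assumes "finite D" and "d \<in> D"
  shows "(\<Sum>v\<in>{v \<in> D. d \<le> v}. Psi D f v) = f d"
proof -
  have "{v \<in> D. d \<le> v} = insert d {v \<in> D. d < v}"
    using assms(2) by (auto simp: order.order_iff_strict)
  then show ?thesis
    using assms(1) by (simp add: Psi.simps [of D f d])
qed

end

theory Submission
  imports Defs
begin

text \<open>
  Since all joins lie in \<open>D\<close>, inverting the recursion for \<open>\<Psi>\<close> factorizes the join matrix as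
  \<open>E(X) diag(\<Psi>) E(Y)\<^sup>T\<close>, and the theorem is the Cauchy--Binet formula for this product.  For the
  latter, multilinearity expands \<open>det (A B\<^sup>T)\<close> into a sum over all ways to choose one column per row;
  choices with repetitions contribute nothing, and the choices with a given range are the
  permutations of one increasing tuple, whose signed sum is the product of the two minors.
\<close>

lemma bij_betw_compose_permutes:
  assumes h: "bij_betw h A B"
  shows "bij_betw (compose A h) {p. p permutes A} {g \<in> extensional A. bij_betw g A B}"
proof (rule bij_betw_byWitness)
  let ?inv = "\<lambda>g x. if x \<in> A then inv_into A h (g x) else x"
  show "\<forall>p\<in>{p. p permutes A}. ?inv (compose A h p) = p"
    by (auto simp: compose_def permutes_in_image permutes_not_in bij_betw_inv_into_left[OF h]
        intro!: ext)
  show "\<forall>g\<in>{g \<in> extensional A. bij_betw g A B}. compose A h (?inv g) = g"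
    by (auto simp: compose_def extensional_def bij_betw_inv_into_right[OF h] bij_betw_apply
        intro!: ext)
  show "compose A h ` {p. p permutes A} \<subseteq> {g \<in> extensional A. bij_betw g A B}"
    by (auto intro: bij_betw_compose[OF permutes_imp_bij h])
  show "?inv ` {g \<in> extensional A. bij_betw g A B} \<subseteq> {p. p permutes A}"
  proof (clarsimp)
    fix g assume "bij_betw g A B"
    then have "bij_betw (inv_into A h \<circ> g) A A"
      by (rule bij_betw_trans[OF _ bij_betw_inv_into[OF h]])
    then have "bij_betw (?inv g) A A"
      by (rule bij_betw_cong[THEN iffD1, rotated]) simp
    then show "?inv g permutes A"
      by (rule bij_imp_permutes) simp
  qed
qed

lemma sum_injections_by_range:
  fixes F :: "('a \<Rightarrow> 'b) \<Rightarrow> 'c::comm_monoid_add"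
  assumes "finite A" and "finite B"
  shows "(\<Sum>g\<in>{g \<in> A \<rightarrow>\<^sub>E B. inj_on g A}. F g) =
    (\<Sum>K\<in>{K. K \<subseteq> B \<and> card K = card A}. \<Sum>g\<in>{g \<in> extensional A. bij_betw g A K}. F g)"
proof -
  let ?I = "{g \<in> A \<rightarrow>\<^sub>E B. inj_on g A}"
  let ?K = "{K. K \<subseteq> B \<and> card K = card A}"
  have "finite ?I"
    using assms by (simp add: finite_PiE)
  moreover have "finite ?K"
    using assms(2) by simp
  moreover have "(\<lambda>g. g ` A) ` ?I \<subseteq> ?K"
    by (auto simp: card_image)
  ultimately have "(\<Sum>g\<in>?I. F g) = (\<Sum>K\<in>?K. \<Sum>g\<in>{g \<in> ?I. g ` A = K}. F g)"
    by (rule sum.group[symmetric])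
  also have "\<dots> = (\<Sum>K\<in>?K. \<Sum>g\<in>{g \<in> extensional A. bij_betw g A K}. F g)"
    by (intro sum.cong) (auto simp: bij_betw_def PiE_def)
  finally show ?thesis .
qed

lemma increasing_tuplesD:
  assumes "ks \<in> increasing_tuples n m"
  shows "length ks = n" and "distinct ks" and "set ks \<subseteq> {0..<m}"
  using assms by (auto simp: increasing_tuples_def strict_sorted_iff)

lemma bij_betw_set_increasing_tuples:
  "bij_betw set (increasing_tuples n m) {K. K \<subseteq> {0..<m} \<and> card K = n}"
proof (rule bij_betw_byWitness[where f' = sorted_list_of_set])
  show "\<forall>ks\<in>increasing_tuples n m. sorted_list_of_set (set ks) = ks"
    by (auto simp: increasing_tuples_def strict_sorted_iff sorted_list_of_set.idem_if_sorted_distinct)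
  show "\<forall>K\<in>{K. K \<subseteq> {0..<m} \<and> card K = n}. set (sorted_list_of_set K) = K"
    by (auto dest: finite_subset)
  show "set ` increasing_tuples n m \<subseteq> {K. K \<subseteq> {0..<m} \<and> card K = n}"
    by (auto simp: increasing_tuples_def strict_sorted_iff distinct_card)
  show "sorted_list_of_set ` {K. K \<subseteq> {0..<m} \<and> card K = n} \<subseteq> increasing_tuples n m"
  proof clarify
    fix K assume "K \<subseteq> {0..<m}" and "n = card K"
    moreover from this have "finite K"
      using finite_subset by blast
    ultimately show "sorted_list_of_set K \<in> increasing_tuples (card K) m"
      by (auto simp: increasing_tuples_def)
  qed
qed

lemma increasing_tuples_eq_empty:
  assumes "m < n"
  shows "increasing_tuples n m = {}"
proof -
  have "card K \<noteq> n" if "K \<subseteq> {0..<m}" for K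
    using card_mono[OF _ that] assms by simp
  then have "set ` increasing_tuples n m = {}"
    using bij_betw_imp_surj_on[OF bij_betw_set_increasing_tuples] by blast
  then show ?thesis
    by simp
qed

lemma dim_column_submatrix [simp]:
  "dim_row (column_submatrix A ks) = dim_row A"
  "dim_col (column_submatrix A ks) = length ks"
  by (simp_all add: column_submatrix_def)

lemma index_column_submatrix [simp]:
  assumes "i < dim_row A" and "j < length ks"
  shows "column_submatrix A ks $$ (i, j) = A $$ (i, ks ! j)"
  using assms by (simp add: column_submatrix_def mat_of_cols_index col_def)

lemma column_submatrix_carrier:
  assumes "A \<in> carrier_mat n m"
  shows "column_submatrix A ks \<in> carrier_mat n (length ks)"
  using assms by (intro carrier_matI) simp_all

lemma det_column_submatrix_not_distinct:
  fixes A :: "'a::comm_ring_1 mat"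
  assumes A: "A \<in> carrier_mat (length ks) m" and "\<not> distinct ks"
  shows "det (column_submatrix A ks) = 0"
proof -
  obtain i j where ij: "i < length ks" "j < length ks" "i \<noteq> j" and "ks ! i = ks ! j"
    using \<open>\<not> distinct ks\<close> by (auto simp: distinct_conv_nth)
  then have "col (column_submatrix A ks) i = col (column_submatrix A ks) j"
    by (intro eq_vecI) simp_all
  then show ?thesis
    using det_identical_columns[OF column_submatrix_carrier[OF A]] ij by blast
qed

lemma det_column_submatrix_permute_list:
  fixes A :: "'a::comm_ring_1 mat"
  assumes A: "A \<in> carrier_mat (length ks) m" and p: "p permutes {0..<length ks}"
  shows "det (column_submatrix A (permute_list p ks)) = signof p * det (column_submatrix A ks)"
proof -
  let ?n = "length ks" and ?T = "transpose_mat (column_submatrix A ks)"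
  have T: "?T \<in> carrier_mat ?n ?n"
    using column_submatrix_carrier[OF A] by simp
  have "transpose_mat (column_submatrix A (permute_list p ks)) =
      mat ?n ?n (\<lambda>(i, j). ?T $$ (p i, j))"
    using A permutes_in_image[OF p] by (intro eq_matI) (auto simp: permute_list_def)
  then have "det (transpose_mat (column_submatrix A (permute_list p ks))) = signof p * det ?T"
    by (simp only: det_permute_rows[OF T p])
  moreover have "det (transpose_mat (column_submatrix A ls)) = det (column_submatrix A ls)"
    if "length ls = length ks" for ls
    using det_transpose[of _ ?n] column_submatrix_carrier[OF A, of ls] that by simp
  ultimately show ?thesis
    by simp
qed

lemma det_mult_transpose_eq_sum_PiE:
  fixes A B :: "'a::comm_ring_1 mat"
  assumes A: "A \<in> carrier_mat n m" and B: "B \<in> carrier_mat n m"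
  shows "det (A * transpose_mat B) = (\<Sum>g\<in>{0..<n} \<rightarrow>\<^sub>E {0..<m}.
    (\<Prod>i=0..<n. A $$ (i, g i)) * det (column_submatrix B (map g [0..<n])))"
proof -
  let ?P = "{p. p permutes {0..<n}}" and ?G = "{0..<n} \<rightarrow>\<^sub>E {0..<m}"
  have entry: "(A * transpose_mat B) $$ (i, j) = (\<Sum>k=0..<m. A $$ (i, k) * B $$ (j, k))"
    if "i < n" and "j < n" for i j
    using that A B by (simp add: scalar_prod_def)
  have det_columns: "det (column_submatrix B (map g [0..<n])) =
      (\<Sum>p\<in>?P. signof p * (\<Prod>i=0..<n. B $$ (p i, g i)))" for g
  proof -
    have "column_submatrix B (map g [0..<n]) \<in> carrier_mat n n"
      using column_submatrix_carrier[OF B, of "map g [0..<n]"] by simp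
    then show ?thesis
      using B by (auto simp: mat_det_left_def permutes_in_image intro!: sum.cong prod.cong)
  qed
  have "det (A * transpose_mat B) =
      (\<Sum>p\<in>?P. signof p * (\<Prod>i=0..<n. \<Sum>k=0..<m. A $$ (i, k) * B $$ (p i, k)))"
    using A B by (simp add: det_def'[of _ n] entry permutes_in_image del: index_mult_mat(1))
  also have "\<dots> = (\<Sum>p\<in>?P. \<Sum>g\<in>?G. signof p * (\<Prod>i=0..<n. A $$ (i, g i) * B $$ (p i, g i)))"
    by (simp add: prod_sum_PiE sum_distrib_left)
  also have "\<dots> = (\<Sum>g\<in>?G. \<Sum>p\<in>?P. signof p * (\<Prod>i=0..<n. A $$ (i, g i) * B $$ (p i, g i)))"
    by (rule sum.swap)
  also have "\<dots> = (\<Sum>g\<in>?G.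
      (\<Prod>i=0..<n. A $$ (i, g i)) * det (column_submatrix B (map g [0..<n])))"
    by (simp add: det_columns sum_distrib_left prod.distrib mult.left_commute)
  finally show ?thesis .
qed

lemma sum_bijections_det_column_submatrix:
  fixes A B :: "'a::comm_ring_1 mat"
  assumes A: "A \<in> carrier_mat n m" and B: "B \<in> carrier_mat n m"
    and len: "length ks = n" and dist: "distinct ks"
  shows "(\<Sum>g\<in>{g \<in> extensional {0..<n}. bij_betw g {0..<n} (set ks)}.
      (\<Prod>i=0..<n. A $$ (i, g i)) * det (column_submatrix B (map g [0..<n]))) =
    det (column_submatrix A ks) * det (column_submatrix B ks)"
proof -
  let ?P = "{p. p permutes {0..<n}}" and ?F = "\<lambda>g. (\<Prod>i=0..<n. A $$ (i, g i)) *
    det (column_submatrix B (map g [0..<n]))"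
  have cA: "column_submatrix A ks \<in> carrier_mat n n"
    using column_submatrix_carrier[OF A, of ks] len by simp
  have "bij_betw ((!) ks) {0..<n} (set ks)"
    using dist len by (simp add: bij_betw_nth atLeast0LessThan)
  then have "(\<Sum>g\<in>{g \<in> extensional {0..<n}. bij_betw g {0..<n} (set ks)}. ?F g) =
      (\<Sum>p\<in>?P. ?F (compose {0..<n} ((!) ks) p))"
    by (rule sum.reindex_bij_betw[OF bij_betw_compose_permutes, symmetric])
  also have "\<dots> = (\<Sum>p\<in>?P. signof p * (\<Prod>i=0..<n. column_submatrix A ks $$ (i, p i)) *
      det (column_submatrix B ks))"
  proof (rule sum.cong)
    fix p assume "p \<in> ?P"
    then have p: "p permutes {0..<n}"
      by simp
    have "map (compose {0..<n} ((!) ks) p) [0..<n] = permute_list p ks"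
      by (simp add: permute_list_def compose_def len)
    moreover have "(\<Prod>i=0..<n. A $$ (i, compose {0..<n} ((!) ks) p i)) =
        (\<Prod>i=0..<n. column_submatrix A ks $$ (i, p i))"
      using A p len by (intro prod.cong) (auto simp: compose_def permutes_in_image)
    ultimately show "?F (compose {0..<n} ((!) ks) p) =
        signof p * (\<Prod>i=0..<n. column_submatrix A ks $$ (i, p i)) * det (column_submatrix B ks)"
      using det_column_submatrix_permute_list[of B ks m p] B p len by (simp add: mult_ac)
  qed simp
  also have "\<dots> = det (column_submatrix A ks) * det (column_submatrix B ks)"
    by (simp add: det_def'[OF cA] sum_distrib_right)
  finally show ?thesis .
qed

theorem Cauchy_Binet:
  fixes A B :: "'a::comm_ring_1 mat"
  assumes A: "A \<in> carrier_mat n m" and B: "B \<in> carrier_mat n m"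
  shows "det (A * transpose_mat B) = (\<Sum>ks\<in>increasing_tuples n m.
    det (column_submatrix A ks) * det (column_submatrix B ks))"
proof -
  let ?F = "\<lambda>g. (\<Prod>i=0..<n. A $$ (i, g i)) * det (column_submatrix B (map g [0..<n]))"
  let ?bij = "\<lambda>K. {g \<in> extensional {0..<n}. bij_betw g {0..<n} K}"
  have "?F g = 0" if "\<not> inj_on g {0..<n}" for g
    using det_column_submatrix_not_distinct[of B "map g [0..<n]" m] B that by (simp add: distinct_map)
  then have "det (A * transpose_mat B) =
      (\<Sum>g\<in>{g \<in> {0..<n} \<rightarrow>\<^sub>E {0..<m}. inj_on g {0..<n}}. ?F g)"
    unfolding det_mult_transpose_eq_sum_PiE[OF A B]
    by (intro sum.mono_neutral_right) (auto simp: finite_PiE)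
  also have "\<dots> = (\<Sum>K\<in>{K. K \<subseteq> {0..<m} \<and> card K = n}. \<Sum>g\<in>?bij K. ?F g)"
    by (simp add: sum_injections_by_range)
  also have "\<dots> = (\<Sum>ks\<in>increasing_tuples n m. \<Sum>g\<in>?bij (set ks). ?F g)"
    by (rule sum.reindex_bij_betw[OF bij_betw_set_increasing_tuples, symmetric])
  also have "\<dots> = (\<Sum>ks\<in>increasing_tuples n m.
      det (column_submatrix A ks) * det (column_submatrix B ks))"
    by (intro sum.cong refl sum_bijections_det_column_submatrix[OF A B] increasing_tuplesD)
  finally show ?thesis .
qed

lemma det_mat_diag:
  fixes w :: "nat \<Rightarrow> 'a::comm_ring_1"
  shows "det (mat_diag n w) = (\<Prod>i=0..<n. w i)"
proof -
  have "det (mat_diag n w) = prod_list (diag_mat (mat_diag n w))"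
    by (rule det_upper_triangular[of _ n]) (auto simp: mat_diag_def)
  then show ?thesis
    by (simp add: prod_list_diag_prod mat_diag_def)
qed

lemma column_submatrix_mult_mat_diag:
  fixes A :: "'a::comm_semiring_1 mat"
  assumes A: "A \<in> carrier_mat n m" and ks: "set ks \<subseteq> {0..<m}"
  shows "column_submatrix (A * mat_diag m w) ks =
    column_submatrix A ks * mat_diag (length ks) (\<lambda>j. w (ks ! j))"
proof -
  have "ks ! j < m" if "j < length ks" for j
    using nth_mem[OF that] ks by auto
  then show ?thesis
    using A by (intro eq_matI)
      (auto simp: mat_diag_mult_right[OF A] mat_diag_mult_right[OF column_submatrix_carrier[OF A]])
qed

lemma det_column_submatrix_mult_mat_diag:
  fixes A :: "'a::comm_ring_1 mat"
  assumes A: "A \<in> carrier_mat (length ks) m" and ks: "set ks \<subseteq> {0..<m}"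
  shows "det (column_submatrix (A * mat_diag m w) ks) =
    det (column_submatrix A ks) * (\<Prod>k\<leftarrow>ks. w k)"
  by (simp add: column_submatrix_mult_mat_diag[OF A ks] det_mult[OF column_submatrix_carrier[OF A]]
      det_mat_diag prod.list_conv_set_nth)

lemma join_matrix_factorization:
  fixes x y d :: "nat \<Rightarrow> 'a::lattice"
  assumes inj: "inj_on d {..<m}"
    and joins: "\<And>i j. \<lbrakk>i < n; j < n\<rbrakk> \<Longrightarrow> sup (x i) (y j) \<in> d ` {..<m}"
  shows "join_matrix n x y f = incidence_matrix n m x d *
    mat_diag m (\<lambda>k. Psi (d ` {..<m}) f (d k)) * transpose_mat (incidence_matrix n m y d)"
    (is "_ = ?X * mat_diag m ?w * transpose_mat ?Y")
proof -
  let ?D = "d ` {..<m}"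
  have X: "?X \<in> carrier_mat n m" and Y: "?Y \<in> carrier_mat n m"
    by (simp_all add: incidence_matrix_def)
  have "f (sup (x i) (y j)) = (\<Sum>k=0..<m. ?X $$ (i, k) * ?w k * ?Y $$ (j, k))"
    if "i < n" and "j < n" for i j
  proof -
    have "f (sup (x i) (y j)) = (\<Sum>v\<in>{v \<in> ?D. sup (x i) (y j) \<le> v}. Psi ?D f v)"
      using joins[OF that] by (intro sum_Psi_above[symmetric]) auto
    also have "\<dots> = (\<Sum>v\<in>?D. if sup (x i) (y j) \<le> v then Psi ?D f v else 0)"
      by (simp add: sum.inter_filter)
    also have "\<dots> = (\<Sum>k<m. if sup (x i) (y j) \<le> d k then ?w k else 0)"
      by (simp add: sum.reindex[OF inj])
    also have "\<dots> = (\<Sum>k=0..<m. ?X $$ (i, k) * ?w k * ?Y $$ (j, k))"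
      using that by (intro sum.cong) (auto simp: incidence_matrix_def)
    finally show ?thesis .
  qed
  then show ?thesis
    using X Y by (intro eq_matI)
      (simp_all add: join_matrix_def mat_diag_mult_right[OF X] scalar_prod_def)
qed

theorem theorem4p1:
  fixes f :: "'a::lattice \<Rightarrow> complex"
    and n m :: nat
    and x y d :: "nat \<Rightarrow> 'a"
    and D :: "'a set"
  assumes locally_finite: "\<And>a b :: 'a. finite {a..b}"
    and x_indexed: "\<And>i j. \<lbrakk>i < n; j < n; x i \<le> x j\<rbrakk> \<Longrightarrow> i \<le> j"
    and y_indexed: "\<And>i j. \<lbrakk>i < n; j < n; y i \<le> y j\<rbrakk> \<Longrightarrow> i \<le> j"
    and D_eq: "D = d ` {..<m}"
    and d_indexed: "\<And>i j. \<lbrakk>i < m; j < m; d i \<le> d j\<rbrakk> \<Longrightarrow> i \<le> j"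
    and joins_in_D: "\<And>i j. \<lbrakk>i < n; j < n\<rbrakk> \<Longrightarrow> sup (x i) (y j) \<in> D"
  shows "(n > m \<longrightarrow> det (join_matrix n x y f) = 0) \<and>
    (n \<le> m \<longrightarrow>
      det (join_matrix n x y f) =
        (\<Sum>ks\<in>increasing_tuples n m.
          det (column_submatrix (incidence_matrix n m x d) ks) *
          det (column_submatrix (incidence_matrix n m y d) ks) *
          (\<Prod>k\<leftarrow>ks. Psi D f (d k))))"
proof -
  let ?X = "incidence_matrix n m x d" and ?Y = "incidence_matrix n m y d"
  let ?w = "\<lambda>k. Psi D f (d k)"
  have X: "?X \<in> carrier_mat n m" and Y: "?Y \<in> carrier_mat n m"
    by (simp_all add: incidence_matrix_def)
  have "inj_on d {..<m}"
    using d_indexed by (intro inj_onI) (simp add: order_antisym)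
  then have "det (join_matrix n x y f) = det (?X * mat_diag m ?w * transpose_mat ?Y)"
    using joins_in_D by (simp add: join_matrix_factorization D_eq)
  also have "\<dots> = (\<Sum>ks\<in>increasing_tuples n m.
      det (column_submatrix (?X * mat_diag m ?w) ks) * det (column_submatrix ?Y ks))"
    using X Y by (intro Cauchy_Binet) simp_all
  also have "\<dots> = (\<Sum>ks\<in>increasing_tuples n m.
      det (column_submatrix ?X ks) * det (column_submatrix ?Y ks) * (\<Prod>k\<leftarrow>ks. ?w k))"
    using X by (simp add: det_column_submatrix_mult_mat_diag increasing_tuplesD mult_ac)
  finally show ?thesis
    by (simp add: increasing_tuples_eq_empty)
qed

end
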